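(* Let $K$ be a field of characteristic zero and $\mathfrak{g}=(V,[\,,])$ a Lie algebra over $K$. Every central CPA-structure on $\mathfrak{g}$ is associative, and every associative CPA-structure $(V,\cdot)$ on $\mathfrak{g}$ satisfies $\mathfrak{g}\cdot\mathfrak{g}\subseteq Z([\mathfrak{g},\mathfrak{g}])$.
   Context: A commutative post-Lie algebra structure (CPA-structure) on a Lie algebra $\mathfrak{g}=(V,[\,,])$ over $K$ is a $K$-bilinear product $x\cdot y$ on $V$ such that for all $x,y,z\in V$: $x\cdot y=y\cdot x$; $[x,y]\cdot z=x\cdot(y\cdot z)-y\cdot(x\cdot z)$; $x\cdot[y,z]=[x\cdot y,z]+[y,x\cdot z]$. A CPA-structure on $\mathfrak{g}$ is called associative if $\mathfrak{g}\cdot[\mathfrak{g},\mathfrak{g}]=0$, and central if $\mathfrak{g}\cdot\mathfrak{g}\subseteq Z(\mathfrak{g})$. Here $Z(\mathfrak{h})$ denotes the center of a Lie algebra $\mathfrak{h}$, so $Z([\mathfrak{g},\mathfrak{g}])$ is the center of the derived algebra $[\mathfrak{g},\mathfrak{g}]$.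
   Formalization: Z([g,g]) is read as the set of elements of g commuting with [g,g], not as the center of the algebra [g,g]; with the latter the second claim fails, e.g. for g = K with zero bracket and x·y = xy. *)

theory Defs
  imports Complex_Main
begin

definition bilinear_over ::
    "('k::field \<Rightarrow> 'v::ab_group_add \<Rightarrow> 'v) \<Rightarrow> ('v \<Rightarrow> 'v \<Rightarrow> 'v) \<Rightarrow> bool"
  where "bilinear_over scale f \<longleftrightarrow>
    (\<forall>x. Vector_Spaces.linear scale scale (\<lambda>y. f x y)) \<and>
    (\<forall>y. Vector_Spaces.linear scale scale (\<lambda>x. f x y))"

locale lie_algebra = vector_space scale
  for scale :: "'k::field \<Rightarrow> 'v::ab_group_add \<Rightarrow> 'v" +
  fixes bracket :: "'v \<Rightarrow> 'v \<Rightarrow> 'v"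
  assumes bilinear_bracket: "bilinear_over scale bracket"
    and bracket_self: "bracket x x = 0"
    and jacobi: "bracket x (bracket y z) + bracket y (bracket z x) + bracket z (bracket x y) = 0"
begin

definition subspace_product :: "('v \<Rightarrow> 'v \<Rightarrow> 'v) \<Rightarrow> 'v set \<Rightarrow> 'v set \<Rightarrow> 'v set"
  where "subspace_product f A B = span {f x y | x y. x \<in> A \<and> y \<in> B}"

definition derived_algebra :: "'v set"
  where "derived_algebra = subspace_product bracket UNIV UNIV"

definition centralizer :: "'v set \<Rightarrow> 'v set"
  where "centralizer A = {x. \<forall>y\<in>A. bracket x y = 0}"

text \<open>
  For a subalgebra \<open>\<hh>\<close> of \<open>\<gg>\<close>, the notation \<open>Z(\<hh>)\<close> is read as the set of all elements of
  \<open>\<gg>\<close> that commute with \<open>\<hh>\<close>; for \<open>\<hh> = \<gg>\<close> this is the center of \<open>\<gg>\<close>.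
  The bound \<open>Z([\<gg>,\<gg>])\<close> on the products of an associative CPA-structure holds in this sense
  only: the products need not lie in \<open>[\<gg>,\<gg>]\<close> itself. On the one-dimensional Lie algebra \<open>K\<close>,
  the product \<open>x \<cdot> y = x y\<close> is an associative CPA-structure while \<open>[\<gg>,\<gg>] = 0\<close>; on the
  Heisenberg algebra \<open>[e1,e2] = e3\<close>, so is the one whose only nonzero product of basis vectors
  is \<open>e1 \<cdot> e1 = e2\<close>, and \<open>e2\<close> is not in \<open>[\<gg>,\<gg>] = Z(\<gg>)\<close>.
\<close>

definition center :: "'v set"
  where "center = centralizer UNIV"

definition cpa_structure :: "('v \<Rightarrow> 'v \<Rightarrow> 'v) \<Rightarrow> bool"
  where "cpa_structure dot \<longleftrightarrow>
    bilinear_over scale dot \<and>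
    (\<forall>x y. dot x y = dot y x) \<and>
    (\<forall>x y z. dot (bracket x y) z = dot x (dot y z) - dot y (dot x z)) \<and>
    (\<forall>x y z. dot x (bracket y z) = bracket (dot x y) z + bracket y (dot x z))"

definition associative_cpa :: "('v \<Rightarrow> 'v \<Rightarrow> 'v) \<Rightarrow> bool"
  where "associative_cpa dot \<longleftrightarrow>
    cpa_structure dot \<and> subspace_product dot UNIV derived_algebra = {0}"

definition central_cpa :: "('v \<Rightarrow> 'v \<Rightarrow> 'v) \<Rightarrow> bool"
  where "central_cpa dot \<longleftrightarrow>
    cpa_structure dot \<and> subspace_product dot UNIV UNIV \<subseteq> center"

end

end

theory Submission
  imports Defs
begin

context lie_algebra
begin

text \<open>Both implications come from the derivation rule x.[y,z] = [x.y,z] + [y,x.z]. If all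
  products are central, both terms on the right vanish, so x.[y,z] = 0. If products with [g,g]
  vanish and z lies in [g,g], then [y,z] lies there too, so x.[y,z] = 0 and x.z = 0, and the rule
  collapses to [x.y,z] = 0. Since [g,g] and the product subspaces are spans, each identity is
  checked on generators and extended by linearity in one slot.\<close>

lemma bilinear_over_span_zero_right:
  assumes "bilinear_over scale f" and "\<And>s. s \<in> S \<Longrightarrow> f x s = 0" and "y \<in> span S"
  shows "f x y = 0"
proof -
  interpret Vector_Spaces.linear scale scale "f x"
    using assms(1) by (simp add: bilinear_over_def)
  show ?thesis
    using assms(2,3) by (rule eq_0_on_span)
qed

lemma bilinear_over_zero_right:
  "bilinear_over scale f \<Longrightarrow> f x 0 = 0"
  using bilinear_over_span_zero_right[of f "{}"] by simp

lemma bilinear_over_span_zero_left: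
  assumes "bilinear_over scale f" and "\<And>s. s \<in> S \<Longrightarrow> f s y = 0" and "x \<in> span S"
  shows "f x y = 0"
proof (rule bilinear_over_span_zero_right[of "\<lambda>a b. f b a"])
  show "bilinear_over scale (\<lambda>a b. f b a)"
    using assms(1) by (simp add: bilinear_over_def)
qed (use assms in auto)

text \<open>Polarization: expand [x+y,x+y] = 0. The center is defined by brackets with the central
  element on the left, while the derivation rule also has a product on the right.\<close>

lemma bracket_swap_zero:
  assumes "bracket x y = 0"
  shows "bracket y x = 0"
proof -
  interpret r: Vector_Spaces.linear scale scale "bracket z" for z
    using bilinear_bracket by (simp add: bilinear_over_def)
  interpret l: Vector_Spaces.linear scale scale "\<lambda>z. bracket z w" for w
    using bilinear_bracket by (simp add: bilinear_over_def)
  have "0 = bracket (x + y) (x + y)"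
    by (simp only: bracket_self)
  also have "\<dots> = bracket x x + bracket y x + (bracket x y + bracket y y)"
    by (simp only: r.add l.add)
  also have "\<dots> = bracket y x"
    by (simp add: bracket_self assms)
  finally show ?thesis ..
qed

lemma central_imp_associative_cpa:
  assumes "central_cpa dot"
  shows "associative_cpa dot"
proof -
  have cpa: "cpa_structure dot" and bil: "bilinear_over scale dot"
    using assms unfolding central_cpa_def cpa_structure_def by blast+
  have "dot x y \<in> center" for x y
    using assms span_base[of "dot x y" "{dot x y | x y. x \<in> UNIV \<and> y \<in> UNIV}"]
    by (auto simp: central_cpa_def subspace_product_def)
  then have zero: "bracket (dot x y) z = 0" for x y z
    by (simp add: center_def centralizer_def)
  \<comment> \<open>This is the right-hand side of the derivation rule for x.[y,z].\<close>
  have "bracket (dot x y) z + bracket y (dot x z) = 0" for x y z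
    by (simp add: zero bracket_swap_zero[OF zero])
  then have dot_bracket: "dot x (bracket y z) = 0" for x y z
    using cpa unfolding cpa_structure_def by metis
  have dot_derived: "dot x y = 0" if "y \<in> derived_algebra" for x y
  proof (rule bilinear_over_span_zero_right[OF bil])
    show "y \<in> span {bracket a b | a b. a \<in> UNIV \<and> b \<in> UNIV}"
      using that by (simp only: derived_algebra_def subspace_product_def)
  qed (auto simp: dot_bracket)
  have "subspace_product dot UNIV derived_algebra \<subseteq> {0}"
    unfolding subspace_product_def
    by (rule span_minimal) (auto simp: dot_derived)
  then have "subspace_product dot UNIV derived_algebra = {0}"
    using span_zero by (auto simp: subspace_product_def)
  then show ?thesis
    using cpa unfolding associative_cpa_def by blast
qed

lemma associative_cpa_subset_centralizer:
  assumes "associative_cpa dot"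
  shows "subspace_product dot UNIV UNIV \<subseteq> centralizer derived_algebra"
proof -
  have cpa: "cpa_structure dot"
    using assms unfolding associative_cpa_def by blast
  have in_derived: "bracket y z \<in> derived_algebra" for y z
    unfolding derived_algebra_def subspace_product_def by (rule span_base) blast
  \<comment> \<open>Associativity says that a span is {0}; each product is one of its
    generators.\<close>
  have dot_derived: "dot x y = 0" if "y \<in> derived_algebra" for x y
    using assms that span_base[of "dot x y" "{dot x y | x y. x \<in> UNIV \<and> y \<in> derived_algebra}"]
    by (auto simp: associative_cpa_def subspace_product_def)
  have zero: "bracket (dot x y) z = 0" if "z \<in> derived_algebra" for x y z
  proof -
    \<comment> \<open>With z in [g,g], associativity kills the left side through [y,z] and the last
      term through x.z.\<close>
    have "dot x (bracket y z) = bracket (dot x y) z + bracket y (dot x z)"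
      using cpa unfolding cpa_structure_def by blast
    then show ?thesis
      using dot_derived in_derived that bilinear_over_zero_right[OF bilinear_bracket] by simp
  qed
  \<comment> \<open>A general p is a linear combination of products, so linearity of the bracket in
    its left slot, with z fixed, reduces to a single product.\<close>
  have "bracket p z = 0"
    if p: "p \<in> subspace_product dot UNIV UNIV" and z: "z \<in> derived_algebra" for p z
  proof (rule bilinear_over_span_zero_left[OF bilinear_bracket])
    show "p \<in> span {dot x y | x y. x \<in> UNIV \<and> y \<in> UNIV}"
      using p by (simp only: subspace_product_def)
  qed (auto simp: zero[OF z])
  then show ?thesis
    by (auto simp: centralizer_def)
qed

end

theorem lemma2p7:
  fixes scale :: "'k::field_char_0 \<Rightarrow> 'v::ab_group_add \<Rightarrow> 'v"
    and bracket :: "'v \<Rightarrow> 'v \<Rightarrow> 'v"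
  assumes "lie_algebra scale bracket"
  shows "(\<forall>dot. lie_algebra.central_cpa scale bracket dot \<longrightarrow>
            lie_algebra.associative_cpa scale bracket dot) \<and>
         (\<forall>dot. lie_algebra.associative_cpa scale bracket dot \<longrightarrow>
            lie_algebra.subspace_product scale dot UNIV UNIV
              \<subseteq> lie_algebra.centralizer bracket (lie_algebra.derived_algebra scale bracket))"
  using lie_algebra.central_imp_associative_cpa[OF assms]
    lie_algebra.associative_cpa_subset_centralizer[OF assms] by blast

end
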